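(* Let $p$ be a prime and suppose $A_1, \dots, A_t$ form a clique in $\Gamma(U_n)$. Then there are subsets $\mathbf{X}^*_i \subseteq \{ X \in U_{n+2} : u(X) = A_i \}$ for $i = 1, \dots, t$ such that the $t$-partite graph in $\Gamma(U_{n+2})$ whose pieces are $\mathbf{X}^*_1,\dots,\mathbf{X}^*_t$ is naturally isomorphic (with $\mathbf{X}^*_i$ corresponding to the $i$-th piece) to the $t$-partite commuting graph each of whose $t$ pieces is $H_{2m+1}(p)$, where $$m = n - \Big| \bigcup_i \sigma_{A_i} \cup \bigcup_i \tau_{A_i} \Big|.$$
   Context: $U_n = \mathrm{UT}(n,p)$ is the group of $n\times n$ upper triangular matrices with entries in $\mathbb{F}_p$ and ones on the diagonal. For a group $G$, $\Gamma(G)$ is the commuting graph: vertices are the elements of $G$, with an edge between two elements if and only if they commute (an element commutes with itself; loops are allowed, and the $A_i$ forming a clique means that they pairwise commute). For $X\in U_{n+2}$, $u(X)\in U_n$ is the matrix obtained from $X$ by erasing its first and last rows and first and last columns. It is convenient to index the entries of $A\in U_n$ as they sit inside a matrix of $U_{n+2}$, i.e. by $(k,\ell)$ with $2\le k,\ell\le n+1$, so that $u(X)=A$ means $a_{k,\ell}=x_{k,\ell}$ for $2\leq k<\ell\leq n+1$. With this indexing, $\sigma_A\subseteq\{3,\dots,n+1\}$ is the set of (indices of) columns of $A$ having at least one nonzero entry above the diagonal, and $\tau_A\subseteq\{2,\dots,n\}$ is the set of (indices of) rows of $A$ having at least one nonzero entry above the diagonal. $H_{2m+1}(p)=\{[x,y,z]: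 x,y\in\mathbb{F}_p^m, z\in\mathbb{F}_p\}$ with product $[x,y,z][x',y',z']=[x+x',y+y',z+z'+x\cdot y']$ (for $m=0$ this is the group $\mathbb{F}_p$). For subsets $B_1,\dots,B_t$ of a group $G$ (possibly overlapping or equal), the $t$-partite graph with pieces $B_1,\dots,B_t$ has vertex set the disjoint union of the $B_i$, with $b\in B_i$ and $b'\in B_j$, $i\neq j$, adjacent if and only if $b$ and $b'$ commute in $G$; edges within a single piece are ignored. *)

theory Defs
  imports
    "Jordan_Normal_Form.Determinant"
    "Berlekamp_Zassenhaus.Finite_Field"
begin

text \<open>The field with \<open>p\<close> elements is \<open>'p mod_ring\<close> with \<open>'p :: prime_card\<close>,
  i.e. the integers modulo the prime \<open>p = CARD('p)\<close>.\<close>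

section \<open>The groups\<close>

definition UT :: "nat \<Rightarrow> 'a::semiring_1 mat monoid" where
  "UT n = \<lparr>carrier = {A \<in> carrier_mat n n. upper_triangular A \<and> (\<forall>i<n. A $$ (i, i) = 1)},
           mult = (*), one = 1\<^sub>m n\<rparr>"

definition heisenberg :: "nat \<Rightarrow> ('a::comm_ring_1 vec \<times> 'a vec \<times> 'a) monoid" where
  "heisenberg m = \<lparr>carrier = carrier_vec m \<times> carrier_vec m \<times> UNIV,
     mult = (\<lambda>(x, y, z) (x', y', z'). (x + x', y + y', z + z' + scalar_prod x y')),
     one = (0\<^sub>v m, 0\<^sub>v m, 0)\<rparr>"

lemma finite_carrier_mat: "finite (carrier_mat n m :: 'a::finite mat set)"
proof (rule finite_subset)
  show "carrier_mat n m \<subseteq> (\<lambda>f. mat n m f :: 'a mat) ` (({..<n} \<times> {..<m}) \<rightarrow>\<^sub>E UNIV)"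
  proof
    fix A :: "'a mat" assume A: "A \<in> carrier_mat n m"
    have "A = mat n m (restrict (($$) A) ({..<n} \<times> {..<m}))"
      using A by (intro eq_matI) auto
    then show "A \<in> (\<lambda>f. mat n m f) ` (({..<n} \<times> {..<m}) \<rightarrow>\<^sub>E UNIV)"
      by (intro image_eqI[where x = "restrict (($$) A) ({..<n} \<times> {..<m})"]) auto
  qed
  show "finite ((\<lambda>f. mat n m f :: 'a mat) ` (({..<n} \<times> {..<m}) \<rightarrow>\<^sub>E UNIV))"
    by (intro finite_imageI finite_PiE) auto
qed

lemma UT_mult_closed:
  fixes A B :: "'a::semiring_1 mat"
  assumes A: "A \<in> carrier (UT n)" and B: "B \<in> carrier (UT n)"
  shows "A * B \<in> carrier (UT n)"
proof -
  have dA: "A \<in> carrier_mat n n" "\<And>i j. j < i \<Longrightarrow> i < n \<Longrightarrow> A $$ (i, j) = 0"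
    "\<And>i. i < n \<Longrightarrow> A $$ (i, i) = 1"
    using A by (auto simp: UT_def)
  have dB: "B \<in> carrier_mat n n" "\<And>i j. j < i \<Longrightarrow> i < n \<Longrightarrow> B $$ (i, j) = 0"
    "\<And>i. i < n \<Longrightarrow> B $$ (i, i) = 1"
    using B by (auto simp: UT_def)
  have e: "(A * B) $$ (i, j) = (\<Sum>k = 0..<n. A $$ (i, k) * B $$ (k, j))" if "i < n" "j < n" for i j
    using that dA(1) dB(1) by (auto simp: scalar_prod_def intro!: sum.cong)
  have z: "A $$ (i, k) * B $$ (k, j) = 0" if "i < n" "k < n" "j \<le> i" "k \<noteq> i \<or> j < i" for i j k
    using dA(2)[of k i] dB(2)[of j k] that by (cases "k < i") auto
  have "(A * B) $$ (i, j) = 0" if "j < i" "i < n" for i j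
    using that z by (subst e) (auto intro!: sum.neutral)
  moreover have "(A * B) $$ (i, i) = 1" if "i < n" for i
  proof -
    have "(A * B) $$ (i, i) = (\<Sum>k \<in> {i}. A $$ (i, k) * B $$ (k, i))"
      unfolding e[OF that that] using that z by (intro sum.mono_neutral_right) auto
    then show ?thesis using dA(3) dB(3) that by simp
  qed
  ultimately show ?thesis
    using dA(1) dB(1) by (auto simp: UT_def)
qed

lemma group_UT: "group (UT n :: 'a::{field,finite} mat monoid)"
proof (rule groupI)
  let ?G = "UT n :: 'a mat monoid"
  have sub: "carrier ?G \<subseteq> carrier_mat n n"
    by (auto simp: UT_def)
  have one: "1\<^sub>m n \<in> carrier ?G"
    by (auto simp: UT_def)
  have m: "mult ?G = (*)" "one ?G = 1\<^sub>m n"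
    by (simp_all add: UT_def)
  show "A \<otimes>\<^bsub>?G\<^esub> B \<in> carrier ?G" if "A \<in> carrier ?G" "B \<in> carrier ?G" for A B
    using that by (simp add: m UT_mult_closed)
  show "\<one>\<^bsub>?G\<^esub> \<in> carrier ?G"
    using one by (simp add: m)
  show "(A \<otimes>\<^bsub>?G\<^esub> B) \<otimes>\<^bsub>?G\<^esub> C = A \<otimes>\<^bsub>?G\<^esub> (B \<otimes>\<^bsub>?G\<^esub> C)"
    if "A \<in> carrier ?G" "B \<in> carrier ?G" "C \<in> carrier ?G" for A B C
    unfolding m using that sub by (intro assoc_mult_mat) auto
  show "\<one>\<^bsub>?G\<^esub> \<otimes>\<^bsub>?G\<^esub> A = A" if "A \<in> carrier ?G" for A
    unfolding m using that sub by (intro left_mult_one_mat) auto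
  show "\<exists>B \<in> carrier ?G. B \<otimes>\<^bsub>?G\<^esub> A = \<one>\<^bsub>?G\<^esub>" if A: "A \<in> carrier ?G" for A
  proof -
    have cA: "A \<in> carrier_mat n n" and "upper_triangular A" and d: "\<forall>i<n. A $$ (i, i) = 1"
      using A by (auto simp: UT_def)
    then have "det A = prod_list (diag_mat A)"
      by (intro det_upper_triangular)
    also have "diag_mat A = map (\<lambda>_. 1) [0..<n]"
      using cA d by (auto simp: diag_mat_def)
    finally have "det A = 1"
      by (simp add: map_replicate_const)
    then have "A \<in> Units (ring_mat TYPE('a) n ())"
      using det_non_zero_imp_unit[OF cA] by simp
    then obtain C where C: "C \<in> carrier_mat n n" "A * C = 1\<^sub>m n"
      unfolding Units_def ring_mat_def by auto
    have "inj_on (\<lambda>B. B * A) (carrier ?G)"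
    proof (rule inj_onI)
      fix B B' assume B: "B \<in> carrier ?G" "B' \<in> carrier ?G" and eq: "B * A = B' * A"
      have cB: "B \<in> carrier_mat n n" "B' \<in> carrier_mat n n"
        using B sub by auto
      have "B = (B * A) * C"
        using assoc_mult_mat[OF cB(1) cA C(1)] C(2) cB(1) by simp
      also have "\<dots> = B'"
        unfolding eq using assoc_mult_mat[OF cB(2) cA C(1)] C(2) cB(2) by simp
      finally show "B = B'" .
    qed
    moreover have "(\<lambda>B. B * A) ` carrier ?G \<subseteq> carrier ?G"
      using A UT_mult_closed by blast
    moreover have "finite (carrier ?G)"
      using finite_subset[OF sub finite_carrier_mat] .
    ultimately have "(\<lambda>B. B * A) ` carrier ?G = carrier ?G"
      by (intro endo_inj_surj)
    then obtain B where "B \<in> carrier ?G" "B * A = 1\<^sub>m n"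
      using one by (metis (no_types, lifting) imageE)
    then show ?thesis
      unfolding m by blast
  qed
qed

lemma group_heisenberg: "group (heisenberg m :: ('a::comm_ring_1 vec \<times> 'a vec \<times> 'a) monoid)"
proof (rule groupI)
  let ?G = "heisenberg m :: ('a vec \<times> 'a vec \<times> 'a) monoid"
  show "g \<otimes>\<^bsub>?G\<^esub> h \<in> carrier ?G" if "g \<in> carrier ?G" "h \<in> carrier ?G" for g h
    using that by (auto simp: heisenberg_def)
  show "\<one>\<^bsub>?G\<^esub> \<in> carrier ?G"
    by (simp add: heisenberg_def)
  show "(g \<otimes>\<^bsub>?G\<^esub> h) \<otimes>\<^bsub>?G\<^esub> k = g \<otimes>\<^bsub>?G\<^esub> (h \<otimes>\<^bsub>?G\<^esub> k)"
    if "g \<in> carrier ?G" "h \<in> carrier ?G" "k \<in> carrier ?G" for g h k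
  proof -
    have *: "scalar_prod (x + x') y'' + scalar_prod x y' =
        scalar_prod x (y' + y'') + scalar_prod x' y''"
      if "x \<in> carrier_vec m" "x' \<in> carrier_vec m" "y' \<in> carrier_vec m" "y'' \<in> carrier_vec m"
      for x x' y' y'' :: "'a vec"
      using add_scalar_prod_distrib[OF that(1,2,4)] scalar_prod_add_distrib[OF that(1,3,4)]
      by (simp add: ac_simps)
    obtain x y z x' y' z' x'' y'' z'' where
      e: "g = (x, y, z)" "h = (x', y', z')" "k = (x'', y'', z'')"
      by (metis prod_cases3)
    with that have
      c: "x \<in> carrier_vec m" "x' \<in> carrier_vec m" "x'' \<in> carrier_vec m"
      "y \<in> carrier_vec m" "y' \<in> carrier_vec m" "y'' \<in> carrier_vec m"
      by (simp_all add: heisenberg_def)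
    show ?thesis
      using assoc_add_vec[OF c(1,2,3)] assoc_add_vec[OF c(4,5,6)] *[OF c(1,2,5,6)]
      by (simp add: heisenberg_def e algebra_simps)
  qed
  show "\<one>\<^bsub>?G\<^esub> \<otimes>\<^bsub>?G\<^esub> g = g" if "g \<in> carrier ?G" for g
    using that by (auto simp: heisenberg_def)
  show "\<exists>h \<in> carrier ?G. h \<otimes>\<^bsub>?G\<^esub> g = \<one>\<^bsub>?G\<^esub>" if "g \<in> carrier ?G" for g
  proof -
    obtain x y z where g: "g = (x, y, z)"
      by (metis prod_cases3)
    with that have "x \<in> carrier_vec m" "y \<in> carrier_vec m"
      by (simp_all add: heisenberg_def)
    with g show ?thesis
      by (intro bexI[where x = "(- x, - y, scalar_prod x y - z)"]) (simp_all add: heisenberg_def)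
  qed
qed

section \<open>Matrix indexing\<close>

text \<open>Matrix entries are indexed from 0 in the library.\<close>

definition inner_mat :: "'a mat \<Rightarrow> 'a mat" where
  "inner_mat X = mat (dim_row X - 2) (dim_col X - 2) (\<lambda>(i, j). X $$ (i + 1, j + 1))"

text \<open>A matrix \<open>A\<close> of size \<open>n\<close> has its rows and columns numbered \<open>2, \<dots>, n + 1\<close>,
  as they are inside a matrix of size \<open>n + 2\<close> with rows and columns numbered from 1.
  Hence the entry of \<open>A\<close> numbered \<open>(k, l)\<close> is \<open>A $$ (k - 2, l - 2)\<close>.\<close>

definition nonzero_cols :: "nat \<Rightarrow> 'a::zero mat \<Rightarrow> nat set" where
  "nonzero_cols n A = {l. \<exists>k. 2 \<le> k \<and> k < l \<and> l \<le> n + 1 \<and> A $$ (k - 2, l - 2) \<noteq> 0}"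

definition nonzero_rows :: "nat \<Rightarrow> 'a::zero mat \<Rightarrow> nat set" where
  "nonzero_rows n A = {k. \<exists>l. 2 \<le> k \<and> k < l \<and> l \<le> n + 1 \<and> A $$ (k - 2, l - 2) \<noteq> 0}"

section \<open>Commuting graphs\<close>

text \<open>Undirected graphs, loops allowed.\<close>

record 'v graph =
  verts :: "'v set"
  adj :: "'v \<Rightarrow> 'v \<Rightarrow> bool"

definition commuting_graph :: "('a, 'b) monoid_scheme \<Rightarrow> 'a graph" where
  "commuting_graph G = \<lparr>verts = carrier G,
     adj = (\<lambda>x y. x \<in> carrier G \<and> y \<in> carrier G \<and> x \<otimes>\<^bsub>G\<^esub> y = y \<otimes>\<^bsub>G\<^esub> x)\<rparr>"

text \<open>The members of a clique are given as a family, which may have repetitions; a member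
  is required to be adjacent to itself, which is automatic in a commuting graph.\<close>

definition clique_family :: "'v graph \<Rightarrow> 'i set \<Rightarrow> ('i \<Rightarrow> 'v) \<Rightarrow> bool" where
  "clique_family \<Gamma> I a \<longleftrightarrow>
     (\<forall>i\<in>I. a i \<in> verts \<Gamma>) \<and> (\<forall>i\<in>I. \<forall>j\<in>I. adj \<Gamma> (a i) (a j))"

text \<open>The pieces may overlap in \<open>\<Gamma>\<close>, so the vertices are tagged with the index of their piece.\<close>

definition multipartite_graph :: "'v graph \<Rightarrow> 'i set \<Rightarrow> ('i \<Rightarrow> 'v set) \<Rightarrow> ('i \<times> 'v) graph" where
  "multipartite_graph \<Gamma> I B = \<lparr>verts = Sigma I B,
     adj = (\<lambda>(i, b) (j, b'). (i, b) \<in> Sigma I B \<and> (j, b') \<in> Sigma I B \<and> i \<noteq> j \<and> adj \<Gamma> b b')\<rparr>"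

definition graph_iso :: "('v \<Rightarrow> 'w) \<Rightarrow> 'v graph \<Rightarrow> 'w graph \<Rightarrow> bool" where
  "graph_iso f \<Gamma> \<Delta> \<longleftrightarrow> bij_betw f (verts \<Gamma>) (verts \<Delta>) \<and>
     (\<forall>v \<in> verts \<Gamma>. \<forall>w \<in> verts \<Gamma>. adj \<Gamma> v w \<longleftrightarrow> adj \<Delta> (f v) (f w))"

end

theory Submission
  imports Defs
begin

text \<open>
  An element of \<open>U\<^bsub>n+2\<^esub>\<close> that lies over \<open>A\<close> is \<open>A\<close> framed by a row \<open>r\<close> on top, a column \<open>c\<close>
  on the right and a corner entry \<open>z\<close>. Multiplying framed matrices gives
  \<open>(r, z, A, c) * (r', z', A', c') = (r' + r A', z + z' + r \<bullet> c', A A', c + A c')\<close>.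
  If every row \<open>r\<close> in use is fixed by right multiplication with every \<open>A\<^sub>i\<close>, and every column
  \<open>c\<close> by left multiplication, then this is the product of \<open>A\<close> and \<open>A'\<close> next to the
  Heisenberg product of \<open>[r, c, z]\<close> and \<open>[r', c', z']\<close>. As the \<open>A\<^sub>i\<close> commute with one
  another, two such matrices then commute exactly when their Heisenberg coordinates do.

  To have these fixed vectors, let \<open>r\<close> and \<open>c\<close> be supported on the indices outside all the sets
  \<open>\<sigma>\<^bsub>A\<^sub>i\<^esub>\<close> and \<open>\<tau>\<^bsub>A\<^sub>i\<^esub>\<close>: there each \<open>A\<^sub>i\<close> has the rows and the columns of the identity matrix.
  There are \<open>m\<close> such indices. The vectors supported on them are copies of the vectors of length
  \<open>m\<close>, with the same dot product, so each piece is a copy of \<open>H\<^bsub>2m+1\<^esub>(p)\<close>, and the isomorphism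
  only reads off the relevant border entries.
\<close>

section \<open>Bordered matrices\<close>

definition bordered :: "nat \<Rightarrow> 'a::semiring_1 vec \<Rightarrow> 'a \<Rightarrow> 'a mat \<Rightarrow> 'a vec \<Rightarrow> 'a mat" where
  "bordered n r z A c = mat (n + 2) (n + 2) (\<lambda>(i, j).
     if j = 0 then (if i = 0 then 1 else 0)
     else if i = n + 1 then (if j = n + 1 then 1 else 0)
     else if i = 0 then (if j = n + 1 then z else r $ (j - 1))
     else if j = n + 1 then c $ (i - 1)
     else A $$ (i - 1, j - 1))"

lemma bordered_mult:
  fixes A A' :: "'a::comm_semiring_1 mat"
  assumes "A \<in> carrier_mat n n" "A' \<in> carrier_mat n n"
    and "r \<in> carrier_vec n" "r' \<in> carrier_vec n" "c \<in> carrier_vec n" "c' \<in> carrier_vec n"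
  shows "bordered n r z A c * bordered n r' z' A' c' =
    bordered n (r' + transpose_mat A' *\<^sub>v r) (z + z' + r \<bullet> c') (A * A') (c + A *\<^sub>v c')"
    (is "?X * ?Y = ?Z")
proof (rule eq_matI)
  fix i j assume "i < dim_row ?Z" "j < dim_col ?Z"
  then have ij: "i < n + 2" "j < n + 2"
    by (simp_all add: bordered_def)
  \<comment> \<open>The border indices 0 and \<open>n + 1\<close> are split off; what remains is a sum over the inner indices.\<close>
  have "(?X * ?Y) $$ (i, j) = (\<Sum>k = 0..<Suc (Suc n). ?X $$ (i, k) * ?Y $$ (k, j))"
    using ij by (simp add: bordered_def scalar_prod_def)
  also have "\<dots> = ?X $$ (i, 0) * ?Y $$ (0, j)
      + (\<Sum>k = 0..<n. ?X $$ (i, Suc k) * ?Y $$ (Suc k, j))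
      + ?X $$ (i, Suc n) * ?Y $$ (Suc n, j)"
    by (subst sum.atLeast0_lessThan_Suc, subst sum.atLeast0_lessThan_Suc_shift)
      (simp add: comp_def)
  also have "\<dots> = ?Z $$ (i, j)"
    using ij assms
    by (auto simp: bordered_def scalar_prod_def ac_simps intro!: sum.cong sum.neutral)
  finally show "(?X * ?Y) $$ (i, j) = ?Z $$ (i, j)" .
qed (simp_all add: bordered_def)

lemma bordered_UT:
  assumes "A \<in> carrier (UT n)"
  shows "bordered n r z A c \<in> carrier (UT (n + 2))"
  using assms by (auto simp: UT_def bordered_def upper_triangular_def)

lemma inner_mat_bordered:
  assumes "A \<in> carrier_mat n n"
  shows "inner_mat (bordered n r z A c) = A"
  using assms by (intro eq_matI) (auto simp: inner_mat_def bordered_def)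

lemma bordered_inject:
  assumes "bordered n r z A c = bordered n r' z' A' c'"
    and "A \<in> carrier_mat n n" "A' \<in> carrier_mat n n"
    and "r \<in> carrier_vec n" "r' \<in> carrier_vec n" "c \<in> carrier_vec n" "c' \<in> carrier_vec n"
  shows "r = r'" "z = z'" "A = A'" "c = c'"
proof -
  have e: "bordered n r z A c $$ (i, j) = bordered n r' z' A' c' $$ (i, j)" for i j
    using assms(1) by simp
  show "r = r'"
  proof (rule eq_vecI)
    show "r $ k = r' $ k" if "k < dim_vec r'" for k
      using that assms(2-) e[of 0 "k + 1"] by (simp add: bordered_def)
  qed (use assms in simp)
  show "c = c'"
  proof (rule eq_vecI)
    show "c $ k = c' $ k" if "k < dim_vec c'" for k
      using that assms(2-) e[of "k + 1" "n + 1"] by (simp add: bordered_def)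
  qed (use assms in simp)
  show "z = z'"
    using e[of 0 "n + 1"] by (simp add: bordered_def)
  show "A = A'"
    using assms inner_mat_bordered by metis
qed

section \<open>Vectors supported on a set of indices\<close>

text \<open>The vector of length \<open>n\<close> with entry \<open>x $ j\<close> at place \<open>e j\<close>; the places outside the image
  of \<open>e\<close> hold 0.\<close>

definition spread :: "nat \<Rightarrow> nat \<Rightarrow> (nat \<Rightarrow> nat) \<Rightarrow> 'a::zero vec \<Rightarrow> 'a vec" where
  "spread n m e x =
     vec n (\<lambda>k. if k \<in> e ` {0..<m} then x $ inv_into {0..<m} e k else 0)"

context
  fixes n m :: nat and e :: "nat \<Rightarrow> nat"
  assumes inj: "inj_on e {0..<m}" and range: "e ` {0..<m} \<subseteq> {0..<n}"
begin

lemma spread_carrier: "spread n m e x \<in> carrier_vec n"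
  by (simp add: spread_def)

lemma spread_nth: "j < m \<Longrightarrow> spread n m e x $ e j = x $ j"
  using inj range by (simp add: spread_def subset_iff inv_into_f_f)

lemma spread_outside: "k < n \<Longrightarrow> k \<notin> e ` {0..<m} \<Longrightarrow> spread n m e x $ k = 0"
  by (simp add: spread_def)

lemma spread_inject:
  assumes "spread n m e x = spread n m e x'" "x \<in> carrier_vec m" "x' \<in> carrier_vec m"
  shows "x = x'"
proof (rule eq_vecI)
  show "x $ j = x' $ j" if "j < dim_vec x'" for j
    using that assms spread_nth[of j x] spread_nth[of j x'] by simp
qed (use assms in simp)

lemma spread_add:
  fixes x x' :: "'a::monoid_add vec"
  assumes "x \<in> carrier_vec m" "x' \<in> carrier_vec m"
  shows "spread n m e (x + x') = spread n m e x + spread n m e x'"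
proof (rule eq_vecI)
  fix k assume "k < dim_vec (spread n m e x + spread n m e x')"
  then have k: "k < n"
    by (simp add: spread_def)
  then show "spread n m e (x + x') $ k = (spread n m e x + spread n m e x') $ k"
    using assms spread_carrier[of x] spread_carrier[of x']
    by (cases "k \<in> e ` {0..<m}") (auto simp: spread_nth spread_outside)
qed (simp add: spread_def)

lemma spread_scalar_prod:
  fixes x y :: "'a::semiring_0 vec"
  assumes "y \<in> carrier_vec m"
  shows "spread n m e x \<bullet> spread n m e y = x \<bullet> y"
proof -
  have "spread n m e x \<bullet> spread n m e y =
      (\<Sum>k = 0..<n. spread n m e x $ k * spread n m e y $ k)"
    using spread_carrier[of y] by (simp add: scalar_prod_def)
  also have "\<dots> = (\<Sum>k \<in> e ` {0..<m}. spread n m e x $ k * spread n m e y $ k)"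
    using range by (intro sum.mono_neutral_right) (auto simp: spread_outside)
  also have "\<dots> = (\<Sum>j = 0..<m. x $ j * y $ j)"
    using inj by (simp add: sum.reindex spread_nth)
  finally show ?thesis
    using assms by (simp add: scalar_prod_def)
qed

text \<open>A matrix fixes a vector as soon as it agrees with the identity matrix in the columns on
  which the vector is supported, because the other columns get coefficient 0.\<close>

lemma mult_spread_fixed:
  fixes B :: "'a::semiring_1 mat"
  assumes B: "B \<in> carrier_mat n n"
    and id: "\<And>i j. i < n \<Longrightarrow> j \<in> e ` {0..<m} \<Longrightarrow> B $$ (i, j) = (if i = j then 1 else 0)"
  shows "B *\<^sub>v spread n m e x = spread n m e x"
proof -
  let ?v = "spread n m e x"
  show ?thesis
  proof (rule eq_vecI)
    fix i assume "i < dim_vec ?v"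
    then have i: "i < n"
      by (simp add: spread_def)
    have "(B *\<^sub>v ?v) $ i = (\<Sum>j = 0..<n. B $$ (i, j) * ?v $ j)"
      using i B spread_carrier[of x] by (simp add: scalar_prod_def)
    also have "\<dots> = (\<Sum>j = 0..<n. if i = j then ?v $ j else 0)"
    proof (rule sum.cong)
      fix j assume "j \<in> {0..<n}"
      then show "B $$ (i, j) * ?v $ j = (if i = j then ?v $ j else 0)"
        using id[OF i, of j] by (cases "j \<in> e ` {0..<m}") (auto simp: spread_outside)
    qed simp
    finally show "(B *\<^sub>v ?v) $ i = ?v $ i"
      using i by simp
  qed (use B in \<open>simp add: spread_def\<close>)
qed

section \<open>Heisenberg multiplication on the border\<close>

definition heisenberg_border :: "'a::semiring_1 mat \<Rightarrow> 'a vec \<times> 'a vec \<times> 'a \<Rightarrow> 'a mat" where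
  "heisenberg_border A = (\<lambda>(x, y, z). bordered n (spread n m e x) z A (spread n m e y))"

lemma heisenberg_border_inject:
  assumes "heisenberg_border A g = heisenberg_border A' h"
    and "A \<in> carrier_mat n n" "A' \<in> carrier_mat n n"
    and "g \<in> carrier (heisenberg m)" "h \<in> carrier (heisenberg m)"
  shows "A = A'" "g = h"
proof -
  obtain x y z x' y' z' where g: "g = (x, y, z)" and h: "h = (x', y', z')"
    by (metis prod_cases3)
  note eq = bordered_inject[OF assms(1)[unfolded heisenberg_border_def g h prod.case]
      assms(2,3) spread_carrier spread_carrier spread_carrier spread_carrier]
  show "A = A'"
    by (fact eq(3))
  show "g = h"
    using eq assms(4,5) spread_inject by (auto simp: g h heisenberg_def)
qed

text \<open>Of the left factor only the action on columns matters for the border, and of the right factor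
  only the action on rows; where both are trivial, the border multiplies as in the Heisenberg
  group.\<close>

lemma heisenberg_border_mult:
  fixes A A' :: "'a::comm_ring_1 mat"
  assumes A: "A \<in> carrier_mat n n" and A': "A' \<in> carrier_mat n n"
    and col: "\<And>i j. i < n \<Longrightarrow> j \<in> e ` {0..<m} \<Longrightarrow> A $$ (i, j) = (if i = j then 1 else 0)"
    and row: "\<And>i j. i \<in> e ` {0..<m} \<Longrightarrow> j < n \<Longrightarrow> A' $$ (i, j) = (if i = j then 1 else 0)"
    and g: "g \<in> carrier (heisenberg m)" and h: "h \<in> carrier (heisenberg m)"
  shows "heisenberg_border A g * heisenberg_border A' h =
    heisenberg_border (A * A') (g \<otimes>\<^bsub>heisenberg m\<^esub> h)"
proof -
  obtain x y z x' y' z' where gh: "g = (x, y, z)" "h = (x', y', z')"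
    by (metis prod_cases3)
  have c: "x \<in> carrier_vec m" "y \<in> carrier_vec m" "x' \<in> carrier_vec m" "y' \<in> carrier_vec m"
    using g h by (auto simp: gh heisenberg_def)
  have "A *\<^sub>v spread n m e y' = spread n m e y'"
    using A col by (rule mult_spread_fixed)
  moreover have "transpose_mat A' *\<^sub>v spread n m e x = spread n m e x"
    using A' row range by (intro mult_spread_fixed) (auto simp: subset_iff)
  ultimately show ?thesis
    using A A' c comm_add_vec[OF spread_carrier, of "spread n m e x'" x]
    by (simp add: heisenberg_border_def gh heisenberg_def bordered_mult spread_carrier
        spread_add spread_scalar_prod)
qed

end

section \<open>Indices of trivial rows and columns\<close>

lemma identity_outside_nonzero_rows_cols:
  assumes A: "A \<in> carrier (UT n)" and ij: "i < n" "j < n"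
    and out: "j + 2 \<notin> nonzero_cols n A \<or> i + 2 \<notin> nonzero_rows n A"
  shows "A $$ (i, j) = (if i = j then 1 else 0)"
proof (cases i j rule: linorder_cases)
  case less
  show ?thesis
  proof (rule ccontr)
    assume "\<not> ?thesis"
    with less have "A $$ (i + 2 - 2, j + 2 - 2) \<noteq> 0"
      by simp
    with less ij have "j + 2 \<in> nonzero_cols n A" "i + 2 \<in> nonzero_rows n A"
      unfolding nonzero_cols_def nonzero_rows_def mem_Collect_eq
      by (intro exI[where x = "i + 2"] exI[where x = "j + 2"]; simp)+
    with out show False
      by blast
  qed
qed (use A ij in \<open>auto simp: UT_def\<close>)

text \<open>Rows and columns are numbered from 2 in \<open>N\<close>, hence the shift.\<close>

lemma complement_of_index_set:
  assumes "N \<subseteq> {2..n + 1}"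
  obtains e where "bij_betw e {0..<n - card N} {k. k < n \<and> k + 2 \<notin> N}"
proof -
  have shift_back: "Suc (Suc (k - 2)) = k" if "2 \<le> k" for k
    using that by simp
  have "bij_betw (\<lambda>k. k + 2) {k. k < n \<and> k + 2 \<notin> N} ({2..n + 1} - N)"
    by (rule bij_betw_byWitness[where f' = "\<lambda>k. k - 2"]) (auto simp: shift_back)
  then have "card {k. k < n \<and> k + 2 \<notin> N} = card ({2..n + 1} - N)"
    by (rule bij_betw_same_card)
  also have "\<dots> = n - card N"
    using assms finite_subset[OF assms] by (simp add: card_Diff_subset)
  finally show thesis
    using ex_bij_betw_nat_finite[of "{k. k < n \<and> k + 2 \<notin> N}"] that by auto
qed

section \<open>Isomorphisms of multipartite graphs\<close>

text \<open>Isomorphisms of multipartite graphs that respect the pieces arise from injective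
  parametrizations of the pieces that match adjacency between different pieces.\<close>

lemma multipartite_graph_iso:
  assumes inj: "\<And>i. i \<in> I \<Longrightarrow> inj_on (\<phi> i) (B i)"
    and adj: "\<And>i j b b'. i \<in> I \<Longrightarrow> j \<in> I \<Longrightarrow> b \<in> B i \<Longrightarrow> b' \<in> B j \<Longrightarrow>
      adj \<Gamma> (\<phi> i b) (\<phi> j b') \<longleftrightarrow> adj \<Delta> b b'"
  shows "\<exists>f. graph_iso f (multipartite_graph \<Gamma> I (\<lambda>i. \<phi> i ` B i)) (multipartite_graph \<Delta> I B)
    \<and> (\<forall>i\<in>I. f ` ({i} \<times> \<phi> i ` B i) = {i} \<times> B i)"
proof (intro exI conjI)
  let ?f = "\<lambda>(i, y). (i, inv_into (B i) (\<phi> i) y)"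
  have f: "?f (i, \<phi> i b) = (i, b)" if "i \<in> I" "b \<in> B i" for i b
    using inj that by simp
  show pieces: "\<forall>i\<in>I. ?f ` ({i} \<times> \<phi> i ` B i) = {i} \<times> B i"
  proof
    fix i assume i: "i \<in> I"
    have "{i} \<times> \<phi> i ` B i = (\<lambda>b. (i, \<phi> i b)) ` B i"
      by auto
    then have "?f ` ({i} \<times> \<phi> i ` B i) = (\<lambda>b. ?f (i, \<phi> i b)) ` B i"
      by (simp only: image_image)
    also have "\<dots> = (\<lambda>b. (i, b)) ` B i"
      by (intro image_cong f i refl)
    finally show "?f ` ({i} \<times> \<phi> i ` B i) = {i} \<times> B i"
      by auto
  qed
  have "bij_betw ?f (Sigma I (\<lambda>i. \<phi> i ` B i)) (Sigma I B)"
    by (rule bij_betw_byWitness[where f' = "\<lambda>(i, b). (i, \<phi> i b)"]) (auto simp: inj)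
  then show "graph_iso ?f (multipartite_graph \<Gamma> I (\<lambda>i. \<phi> i ` B i)) (multipartite_graph \<Delta> I B)"
    by (auto simp: graph_iso_def multipartite_graph_def inj adj)
qed

section \<open>Commuting graphs over a clique\<close>

theorem theorem5p13:
  fixes n t m :: nat and A :: "nat \<Rightarrow> 'p::prime_card mod_ring mat"
  assumes "clique_family (commuting_graph (UT n)) {1..t} A"
    and "m = n - card ((\<Union>i\<in>{1..t}. nonzero_cols n (A i)) \<union> (\<Union>i\<in>{1..t}. nonzero_rows n (A i)))"
  shows "\<exists>(X :: nat \<Rightarrow> 'p mod_ring mat set)
           (f :: nat \<times> 'p mod_ring mat \<Rightarrow> nat \<times> ('p mod_ring vec \<times> 'p mod_ring vec \<times> 'p mod_ring)).
      (\<forall>i\<in>{1..t}. X i \<subseteq> {Y \<in> carrier (UT (n + 2)). inner_mat Y = A i}) \<and>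
      graph_iso f
        (multipartite_graph (commuting_graph (UT (n + 2))) {1..t} X)
        (multipartite_graph (commuting_graph (heisenberg m)) {1..t} (\<lambda>_. carrier (heisenberg m))) \<and>
      (\<forall>i\<in>{1..t}. f ` ({i} \<times> X i) = {i} \<times> carrier (heisenberg m))"
proof -
  define N where "N = (\<Union>i\<in>{1..t}. nonzero_cols n (A i)) \<union> (\<Union>i\<in>{1..t}. nonzero_rows n (A i))"
  let ?H = "heisenberg m :: ('p mod_ring vec \<times> 'p mod_ring vec \<times> 'p mod_ring) monoid"
  have A: "A i \<in> carrier (UT n)" and comm: "A i * A j = A j * A i"
    if "i \<in> {1..t}" "j \<in> {1..t}" for i j
    using assms(1) that by (auto simp: clique_family_def commuting_graph_def UT_def)
  have A_mat: "A i \<in> carrier_mat n n" if "i \<in> {1..t}" for i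
    using A[OF that that] by (simp add: UT_def)
  have "N \<subseteq> {2..n + 1}"
    by (auto simp: N_def nonzero_cols_def nonzero_rows_def)
  moreover have "m = n - card N"
    using assms(2) by (simp add: N_def)
  ultimately obtain e where e: "bij_betw e {0..<m} {k. k < n \<and> k + 2 \<notin> N}"
    using complement_of_index_set by metis
  then have inj: "inj_on e {0..<m}" and img: "e ` {0..<m} = {k. k < n \<and> k + 2 \<notin> N}"
    by (auto simp: bij_betw_def)
  then have range: "e ` {0..<m} \<subseteq> {0..<n}"
    by auto
  have id: "A i $$ (k, l) = (if k = l then 1 else 0)"
    if "i \<in> {1..t}" "k < n" "l < n" "k \<in> e ` {0..<m} \<or> l \<in> e ` {0..<m}" for i k l
    using that img A[of i i] by (intro identity_outside_nonzero_rows_cols) (auto simp: N_def)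
  define \<phi> :: "nat \<Rightarrow> 'p mod_ring vec \<times> 'p mod_ring vec \<times> 'p mod_ring \<Rightarrow> 'p mod_ring mat"
    where "\<phi> i = heisenberg_border n m e (A i)" for i
  have UT: "\<phi> i g \<in> carrier (UT (n + 2))" and inner: "inner_mat (\<phi> i g) = A i"
    if "i \<in> {1..t}" for i g
    using bordered_UT[OF A[OF that that]] inner_mat_bordered[OF A_mat[OF that]]
    by (auto simp: \<phi>_def heisenberg_border_def[OF inj range] split: prod.split)
  have mult: "\<phi> i g * \<phi> j h = heisenberg_border n m e (A i * A j) (g \<otimes>\<^bsub>?H\<^esub> h)"
    if "i \<in> {1..t}" "j \<in> {1..t}" "g \<in> carrier ?H" "h \<in> carrier ?H" for i j g h
    unfolding \<phi>_def using that range
    by (intro heisenberg_border_mult[OF inj range] A_mat id) auto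
  have "\<phi> i g * \<phi> j h = \<phi> j h * \<phi> i g \<longleftrightarrow> g \<otimes>\<^bsub>?H\<^esub> h = h \<otimes>\<^bsub>?H\<^esub> g"
    if ij: "i \<in> {1..t}" "j \<in> {1..t}" and gh: "g \<in> carrier ?H" "h \<in> carrier ?H" for i j g h
  proof -
    have "g \<otimes>\<^bsub>?H\<^esub> h \<in> carrier ?H" "h \<otimes>\<^bsub>?H\<^esub> g \<in> carrier ?H"
      using gh by (simp_all add: group.is_monoid group_heisenberg monoid.m_closed)
    moreover have "A i * A j \<in> carrier_mat n n"
      using A_mat[OF ij(1)] A_mat[OF ij(2)] by simp
    moreover have "\<phi> j h * \<phi> i g = heisenberg_border n m e (A i * A j) (h \<otimes>\<^bsub>?H\<^esub> g)"
      using mult[OF ij(2,1) gh(2,1)] by (simp add: comm[OF ij])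
    ultimately show ?thesis
      by (metis mult[OF ij gh] heisenberg_border_inject(2)[OF inj range])
  qed
  then have "adj (commuting_graph (UT (n + 2))) (\<phi> i g) (\<phi> j h) \<longleftrightarrow>
      adj (commuting_graph ?H) g h"
    if "i \<in> {1..t}" "j \<in> {1..t}" "g \<in> carrier ?H" "h \<in> carrier ?H" for i j g h
    using that UT by (simp add: commuting_graph_def UT_def)
  moreover have "inj_on (\<phi> i) (carrier ?H)" if "i \<in> {1..t}" for i
    using heisenberg_border_inject(2)[OF inj range _ A_mat A_mat] that
    by (auto simp: \<phi>_def intro!: inj_onI)
  ultimately obtain f where
    "graph_iso f (multipartite_graph (commuting_graph (UT (n + 2))) {1..t} (\<lambda>i. \<phi> i ` carrier ?H))
      (multipartite_graph (commuting_graph ?H) {1..t} (\<lambda>_. carrier ?H))"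
    "\<forall>i\<in>{1..t}. f ` ({i} \<times> \<phi> i ` carrier ?H) = {i} \<times> carrier ?H"
    using multipartite_graph_iso[of "{1..t}" \<phi> "\<lambda>_. carrier ?H"
        "commuting_graph (UT (n + 2))" "commuting_graph ?H"]
    by blast
  moreover have "\<forall>i\<in>{1..t}. \<phi> i ` carrier ?H \<subseteq> {Y \<in> carrier (UT (n + 2)). inner_mat Y = A i}"
    using UT inner by auto
  ultimately show ?thesis
    by (intro exI[where x = "\<lambda>i. \<phi> i ` carrier ?H"] exI[where x = f]) simp
qed

end
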